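(* For any $\alpha \in \mathbb{R}$, $$\dim \mathbf{Bad}_\alpha = 1 .$$
   Context: $\dim$ denotes Hausdorff dimension. For $t \in \mathbb{R}$, $\|t\|$ denotes the distance from $t$ to the nearest integer, and $\mathbb{N} = \{1, 2, 3, \dots\}$. For $\alpha \in \mathbb{R}$, the set $\mathbf{Bad}_\alpha$ is defined by $$\mathbf{Bad}_\alpha := \left\{ x \in [0,1) : \exists\, c(x) > 0 \text{ such that } \|q\alpha - x\| \geq \frac{c(x)}{q} \ \text{ for all } q \in \mathbb{N} \right\}.$$ *)

theory Defs
  imports "HOL-Analysis.Analysis"
begin

text \<open>
  The contribution of a covering set to the \<open>s\<close>-dimensional Hausdorff measure. The case \<open>s = 0\<close> is
  separate because \<open>0 powr 0 = 0\<close>, whereas the usual convention makes every nonempty set (also a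
  singleton) contribute \<open>1\<close>.
\<close>
definition diam_pow :: "real \<Rightarrow> 'a::metric_space set \<Rightarrow> ennreal" where
  "diam_pow s U =
     (if s = 0 then (if U = {} then 0 else 1) else ennreal (diameter U powr s))"

text \<open>
  Boundedness has to be required explicitly, since \<^const>\<open>diameter\<close> is a real number that is
  meaningless for unbounded sets. Finite covers are included, as members of a cover may be empty.
\<close>
definition delta_covers :: "real \<Rightarrow> 'a::metric_space set \<Rightarrow> (nat \<Rightarrow> 'a set) set" where
  "delta_covers \<delta> A = {U. A \<subseteq> (\<Union>i. U i) \<and> (\<forall>i. bounded (U i) \<and> diameter (U i) \<le> \<delta>)}"

definition hausdorff_premeasure :: "real \<Rightarrow> real \<Rightarrow> 'a::metric_space set \<Rightarrow> ennreal" where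
  "hausdorff_premeasure s \<delta> A = (INF U\<in>delta_covers \<delta> A. \<Sum>i. diam_pow s (U i))"

text \<open>The supremum is the limit as \<open>\<delta>\<close> tends to \<open>0\<close>, the premeasure being antitone in \<open>\<delta>\<close>.\<close>
definition hausdorff_measure :: "real \<Rightarrow> 'a::metric_space set \<Rightarrow> ennreal" where
  "hausdorff_measure s A = (SUP \<delta>\<in>{0<..}. hausdorff_premeasure s \<delta> A)"

definition hausdorff_dim :: "'a::metric_space set \<Rightarrow> ennreal" where
  "hausdorff_dim A = (INF s\<in>{s. 0 \<le> s \<and> hausdorff_measure s A = 0}. ennreal s)"

definition dist_int :: "real \<Rightarrow> real" where
  "dist_int t = \<bar>t - of_int (round t)\<bar>"

lemma dist_int_eq_infdist: "dist_int t = infdist t \<int>"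
proof (rule antisym)
  show "infdist t \<int> \<le> dist_int t"
    using infdist_le[of "of_int (round t)" \<int> t] by (simp add: dist_int_def dist_real_def)
  have "dist_int t \<le> dist t a" if "a \<in> \<int>" for a
    using that round_diff_minimal[of t]
    by (auto simp: dist_int_def dist_real_def elim!: Ints_cases)
  moreover have "(\<int> :: real set) \<noteq> {}"
    using Ints_0 by blast
  ultimately show "dist_int t \<le> infdist t \<int>"
    by (auto simp: infdist_notempty intro!: cINF_greatest)
qed

definition Bad :: "real \<Rightarrow> real set" where
  "Bad \<alpha> = {x. 0 \<le> x \<and> x < 1 \<and>
     (\<exists>c>0. \<forall>q::nat. q \<ge> 1 \<longrightarrow> dist_int (real q * \<alpha> - x) \<ge> c / real q)}"

end

theory Submission
  imports Defs "HOL-Real_Asymp.Real_Asymp"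
begin

text \<open>
  Write \<open>\<parallel>t\<parallel>\<close> for \<^term>\<open>dist_int t\<close>. The upper bound is elementary: \<^term>\<open>Bad \<alpha>\<close> lies in the unit interval,
  whose dimension is at most \<open>1\<close>. For the lower bound, the inhomogeneous condition on \<open>q\<alpha> - x\<close> is
  deduced from a homogeneous condition on \<open>x\<close> along a lacunary sequence. Fix an integer \<open>R \<ge> 2\<close> and
  let \<open>N m\<close> minimise \<open>\<parallel>n\<alpha>\<parallel>\<close> over the block \<open>R ^ m \<le> n < R ^ (m + 1)\<close>. By the triangle inequality
  \<open>\<parallel>N m x\<parallel> \<le> N m \<parallel>q\<alpha> - x\<parallel> + q \<parallel>N m \<alpha>\<parallel>\<close>, and Dirichlet's theorem supplies, for each \<open>q\<close>, a block
  with \<open>N m = O(q)\<close> for which the last term is small. Hence \<open>x\<close> is in \<^term>\<open>Bad \<alpha>\<close> as soon as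
  \<open>\<parallel>N m x\<parallel> \<ge> \<delta>\<close> for all \<open>m\<close> and some \<open>\<delta> > 0\<close> (\<open>mem_Bad_if_lacunary\<close>). Minimising over blocks gives
  one condition per scale, for rational and irrational \<open>\<alpha>\<close> alike, without continued fractions.

  It remains to see that such \<open>x\<close> cannot be covered by sets \<open>U i\<close> for which
  \<open>\<Sum>i. diameter (U i) powr s\<close> is tiny, when \<open>0 < s < 1\<close>. Instead of building a measure on a Cantor set,
  the proof constructs, for a given cover, one point that escapes it (\<open>exists_point_avoiding\<close>). In
  an interval of length \<open>L\<close>, cut into \<open>R\<close> cells, the condition of the current scale excludes at
  most three cells, and a covering set shorter than a cell meets at most three. So some
  remaining cell meets covering sets of total weight at most \<open>3 / (R - 3)\<close> times the weight met
  by the whole interval. For large \<open>R\<close> this factor is at most \<open>R powr (-s)\<close>, because \<open>s < 1\<close>; thus the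
  weight shrinks at least as fast as \<open>L powr s\<close>. This is self-sustaining: while
  the weight is below the \<open>s\<close>-th power of the cell length, every set that is met is shorter than a cell.
  Iterating leads to a point that would lie only in covering sets of weight zero. The weights are
  made positive beforehand, so that there are no such sets.
\<close>

section \<open>Counting the cells that a short set meets\<close>

lemma card_nat_diff_le:
  fixes T :: "nat set"
  assumes "\<And>t t'. t \<in> T \<Longrightarrow> t' \<in> T \<Longrightarrow> t' \<le> t + k"
  shows "card T \<le> k + 1"
proof (cases "T = {}")
  case False
  then obtain t0 where t0: "t0 \<in> T" "\<And>t. t \<in> T \<Longrightarrow> t0 \<le> t"
    using that[of "LEAST t. t \<in> T"] by (meson LeastI Least_le ex_in_conv)
  have "T \<subseteq> {t0..t0 + k}"
  proof
    fix t assume "t \<in> T"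
    then show "t \<in> {t0..t0 + k}" using t0 assms[OF t0(1)] by simp
  qed
  from card_mono[OF _ this] show ?thesis by simp
qed simp

text \<open>
  The left end points of two cells met by \<open>W\<close> are at distance at most \<open>2 * h\<close>. The cells are closed, and
  therefore overlap at their ends, so that compactness gives nested ones a common point.
\<close>
lemma card_cells_meeting_small_set:
  fixes a h :: real and W :: "real set" and T :: "nat set"
  assumes "h > 0" and W: "\<And>x y. x \<in> W \<Longrightarrow> y \<in> W \<Longrightarrow> \<bar>x - y\<bar> \<le> h"
  shows "card {t. t \<in> T \<and> W \<inter> {a + t * h..a + (real t + 1) * h} \<noteq> {}} \<le> 3"
proof -
  have "t' \<le> t + 2"
    if t: "W \<inter> {a + t * h..a + (real t + 1) * h} \<noteq> {}"
      and t': "W \<inter> {a + t' * h..a + (real t' + 1) * h} \<noteq> {}" for t t' :: nat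
  proof -
    obtain y y' where y: "y \<in> W" "y \<le> a + (real t + 1) * h" and y': "y' \<in> W" "a + t' * h \<le> y'"
      using t t' by auto
    then have "t' * h \<le> (t + 2) * h"
      using W[of y' y] by (simp add: algebra_simps)
    then show ?thesis
      using \<open>h > 0\<close> by (simp flip: of_nat_add)
  qed
  then show ?thesis
    using card_nat_diff_le[of "{t. t \<in> T \<and> W \<inter> {a + t * h..a + (real t + 1) * h} \<noteq> {}}" 2] by auto
qed

section \<open>A point that escapes a light cover\<close>

text \<open>
  The weight \<open>w i\<close> replaces \<open>diameter (U i) powr s\<close>. Its strict positivity matters: a
  singleton has diameter \<open>0\<close>, so a cover by countably many points would otherwise weigh nothing.
\<close>
locale weighted_cover =
  fixes s :: real and R :: nat and U :: "nat \<Rightarrow> real set" and w :: "nat \<Rightarrow> real"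
  assumes s_pos: "0 < s" and R_large: "3 * real R powr s \<le> real R - 3"
    and w_pos: "\<And>i. 0 < w i" and w_summable: "summable w"
    and U_small: "\<And>i x y. x \<in> U i \<Longrightarrow> y \<in> U i \<Longrightarrow> \<bar>x - y\<bar> powr s \<le> w i"
begin

lemma R_pos: "0 < R" and R_gt_1: "1 < R"
  using R_large powr_ge_zero[of "real R" s] by linarith+

text \<open>Total weight of the covering sets that a point chosen inside \<open>A\<close> could still fall into.\<close>
definition met_weight :: "real set \<Rightarrow> real" where
  "met_weight A = (\<Sum>i. if U i \<inter> A \<noteq> {} then w i else 0)"

lemma summable_met: "summable (\<lambda>i. if P i then w i else 0)"
  by (rule summable_comparison_test'[OF w_summable, of 0]) (use w_pos in \<open>auto simp: less_imp_le\<close>)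

lemma weight_le_met_weight:
  assumes "U i \<inter> A \<noteq> {}"
  shows "w i \<le> met_weight A"
proof -
  have "(\<Sum>j\<in>{i}. if U j \<inter> A \<noteq> {} then w j else 0) \<le> met_weight A"
    unfolding met_weight_def
    by (rule sum_le_suminf[OF summable_met]) (use w_pos in \<open>auto simp: less_imp_le\<close>)
  then show ?thesis using assms by simp
qed

lemma met_weight_le_suminf: "met_weight A \<le> suminf w"
  unfolding met_weight_def
  by (rule suminf_le[OF _ summable_met w_summable]) (use w_pos in \<open>auto simp: less_imp_le\<close>)

text \<open>
  An averaging argument. If all cells not excluded by \<open>V\<close> were too heavy, their total weight would be
  at least \<open>(R - 3) * (h / R) powr s\<close>. But each covering set is counted at most three times in this
  total, because the bound on the weight forces the sets that are met to be no longer than \<open>h\<close>.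
\<close>
lemma exists_light_cell:
  fixes a h :: real and V :: "real set"
  assumes "h > 0"
    and light: "met_weight {a..a + R * h} < h powr s"
    and V: "\<And>x y. x \<in> V \<Longrightarrow> y \<in> V \<Longrightarrow> \<bar>x - y\<bar> \<le> R * h \<Longrightarrow> \<bar>x - y\<bar> \<le> h"
  shows "\<exists>a'. a \<le> a' \<and> a' + h \<le> a + R * h \<and> {a'..a' + h} \<inter> V = {} \<and>
    met_weight {a'..a' + h} < (h / R) powr s"
proof (rule ccontr)
  assume no_cell: "\<not> ?thesis"
  define J where "J t = {a + real t * h..a + (real t + 1) * h}" for t :: nat
  define I where "I = {a..a + R * h}"
  have J_sub: "J t \<subseteq> I" if "t < R" for t
  proof -
    have "(real t + 1) * h \<le> R * h"
      using that \<open>h > 0\<close> by (intro mult_right_mono) auto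
    then show ?thesis using \<open>h > 0\<close> by (auto simp: J_def I_def intro: order_trans[rotated])
  qed
  define B where "B = {t. t \<in> {..<R} \<and> (V \<inter> I) \<inter> J t \<noteq> {}}"
  define G where "G = {..<R} - B"
  have "card B \<le> 3"
    unfolding B_def J_def using \<open>h > 0\<close>
    by (intro card_cells_meeting_small_set) (auto simp: I_def intro!: V)
  then have card_G: "real R - 3 \<le> card G"
    using diff_card_le_card_Diff[of B "{..<R}"] by (simp add: B_def G_def)
  have "(h / R) powr s \<le> met_weight (J t)" if "t \<in> G" for t
  proof -
    have "t < R" "J t \<inter> V = {}"
      using that J_sub by (auto simp: G_def B_def)
    moreover have "J t = {a + t * h..a + t * h + h}"
      by (simp add: J_def algebra_simps)
    ultimately show ?thesis
      using no_cell J_sub[of t] \<open>h > 0\<close> by (auto simp: I_def not_less)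
  qed
  then have "card G * (h / R) powr s \<le> (\<Sum>t\<in>G. met_weight (J t))"
    by (intro sum_bounded_below) auto
  also have "\<dots> = (\<Sum>i. \<Sum>t\<in>G. if U i \<inter> J t \<noteq> {} then w i else 0)"
    unfolding met_weight_def by (rule suminf_sum[symmetric]) (rule summable_met)
  also have "\<dots> \<le> (\<Sum>i. 3 * (if U i \<inter> I \<noteq> {} then w i else 0))"
  proof (rule suminf_le)
    fix i
    have "(\<Sum>t\<in>G. if U i \<inter> J t \<noteq> {} then w i else 0) = card {t. t \<in> G \<and> U i \<inter> J t \<noteq> {}} * w i"
      by (simp add: sum.If_cases G_def Int_def)
    also have "\<dots> \<le> 3 * (if U i \<inter> I \<noteq> {} then w i else 0)"
    proof (cases "U i \<inter> I = {}")
      case True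
      then have "{t. t \<in> G \<and> U i \<inter> J t \<noteq> {}} = {}"
        using J_sub by (fastforce simp: G_def)
      then show ?thesis using True by (simp only: card.empty) simp
    next
      case False
      have "w i < h powr s"
        using weight_le_met_weight[OF False] light by (simp add: I_def)
      then have "\<bar>x - y\<bar> \<le> h" if "x \<in> U i" "y \<in> U i" for x y
        using U_small[OF that] powr_less_mono2[OF s_pos, of h "\<bar>x - y\<bar>"] \<open>h > 0\<close> by fastforce
      then have "card {t. t \<in> G \<and> U i \<inter> J t \<noteq> {}} \<le> 3"
        unfolding J_def using \<open>h > 0\<close> by (intro card_cells_meeting_small_set) auto
      then show ?thesis using False w_pos[of i] by simp
    qed
    finally show "(\<Sum>t\<in>G. if U i \<inter> J t \<noteq> {} then w i else 0) \<le> 3 * (if U i \<inter> I \<noteq> {} then w i else 0)" .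
  qed (intro summable_sum summable_mult summable_met)+
  also have "\<dots> = 3 * met_weight I"
    unfolding met_weight_def by (rule suminf_mult) (rule summable_met)
  also have "\<dots> < 3 * h powr s"
    using light by (simp add: I_def)
  also have "\<dots> = (3 * R powr s) * (h / R) powr s"
    using R_pos \<open>h > 0\<close> by (simp add: powr_divide)
  also have "\<dots> \<le> card G * (h / R) powr s"
    using card_G R_large by (intro mult_right_mono) auto
  finally show False by simp
qed

text \<open>
  In the nested intervals \<open>I m (a m)\<close> of length \<open>R ^ (-m)\<close> the weight that is met tends to \<open>0\<close>. A
  covering set containing the limit point meets all of them, so its weight would be \<open>0\<close>.
  Avoiding \<open>V m\<close> costs only the step from \<open>m\<close> to \<open>m + 1\<close>, as the hypothesis says that the part of \<open>V m\<close> within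
  the current interval is no longer than a cell.
\<close>
lemma exists_point_avoiding:
  fixes V :: "nat \<Rightarrow> real set"
  assumes light: "suminf w < (1 / R) powr s"
    and V: "\<And>m x y. x \<in> V m \<Longrightarrow> y \<in> V m \<Longrightarrow>
      \<bar>x - y\<bar> \<le> (1 / R) ^ m \<Longrightarrow> \<bar>x - y\<bar> \<le> (1 / R) ^ Suc m"
  shows "\<exists>x. 0 \<le> x \<and> x \<le> 1 \<and> (\<forall>m. x \<notin> V m) \<and> (\<forall>i. x \<notin> U i)"
proof -
  define l :: "nat \<Rightarrow> real" where "l m = (1 / R) ^ m" for m
  define I where "I m a = {a..a + l m}" for m and a :: real
  have l_pos: "l m > 0" for m
    using R_pos by (simp add: l_def)
  have l_Suc: "R * l (Suc m) = l m" "l (Suc m) / R = l (Suc (Suc m))" for m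
    using R_pos by (simp_all add: l_def)
  \<comment> \<open>The clause for \<open>m = 0\<close> makes the unit interval the first of the sequence.\<close>
  have "\<exists>a. \<forall>m. ((m = 0 \<longrightarrow> a m = 0) \<and> met_weight (I m (a m)) < l (Suc m) powr s) \<and>
      (a m \<le> a (Suc m) \<and> a (Suc m) + l (Suc m) \<le> a m + l m \<and> I (Suc m) (a (Suc m)) \<inter> V m = {})"
  proof (rule dependent_nat_choice)
    show "\<exists>a. ((0::nat) = 0 \<longrightarrow> a = 0) \<and> met_weight (I 0 a) < l (Suc 0) powr s"
      using met_weight_le_suminf[of "I 0 0"] light by (auto simp: l_def)
  next
    fix a m
    assume "(m = 0 \<longrightarrow> a = 0) \<and> met_weight (I m a) < l (Suc m) powr s"
    then show "\<exists>a'. ((Suc m = 0 \<longrightarrow> a' = 0) \<and> met_weight (I (Suc m) a') < l (Suc (Suc m)) powr s) \<and>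
        (a \<le> a' \<and> a' + l (Suc m) \<le> a + l m \<and> I (Suc m) a' \<inter> V m = {})"
      using exists_light_cell[OF l_pos[of "Suc m"], of a "V m"] V[where m = m]
      unfolding l_Suc I_def by (auto simp: l_def)
  qed
  then obtain a where a0: "a 0 = 0" and a_light: "\<And>m. met_weight (I m (a m)) < l (Suc m) powr s"
    and a_mono: "\<And>m. a m \<le> a (Suc m)" and b_mono: "\<And>m. a (Suc m) + l (Suc m) \<le> a m + l m"
    and a_V: "\<And>m. I (Suc m) (a (Suc m)) \<inter> V m = {}"
    by blast
  define x where "x = (SUP m. a m)"
  have inc: "incseq a" and dec: "decseq (\<lambda>m. a m + l m)"
    using a_mono b_mono by (auto intro: incseq_SucI decseq_SucI)
  have below: "a k \<le> a m + l m" for k m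
    using incseqD[OF inc, of k "max k m"] decseqD[OF dec, of m "max k m"] l_pos[of "max k m"]
    by (simp add: max_def split: if_splits)
  have x_in: "x \<in> I m (a m)" for m
    unfolding I_def x_def using below
    by (auto intro!: cSUP_upper cSUP_least bdd_aboveI2[where M = "a 0 + l 0"])
  have "x \<notin> V m" for m
    using a_V[of m] x_in[of "Suc m"] by auto
  moreover have "x \<notin> U i" for i
  proof
    assume "x \<in> U i"
    then have "w i \<le> l (Suc m) powr s" for m
      using weight_le_met_weight[of i "I m (a m)"] a_light[of m] x_in[of m] by fastforce
    moreover have "(\<lambda>m. l (Suc m) powr s) \<longlonglongrightarrow> 0"
    proof -
      have "(\<lambda>m. (1 / real R) ^ Suc m) \<longlonglongrightarrow> 0"
        using R_gt_1 by (intro LIMSEQ_Suc LIMSEQ_realpow_zero) auto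
      then show ?thesis
        using tendsto_powr'[OF _ tendsto_const, of "\<lambda>m. l (Suc m)" 0 sequentially s] s_pos
        by (simp add: l_def)
    qed
    ultimately have "w i \<le> 0"
      by (intro LIMSEQ_le_const) auto
    then show False using w_pos[of i] by simp
  qed
  ultimately show ?thesis
    using x_in[of 0] a0 by (auto simp: I_def l_def)
qed

end

section \<open>From lacunary multiples to \<open>Bad\<close>\<close>

lemma dist_int_le: "dist_int t \<le> \<bar>t - of_int p\<bar>"
  unfolding dist_int_def by (rule round_diff_minimal)

text \<open>
  The components of the set where \<open>\<parallel>n x\<parallel>\<close> is small are spaced by \<open>1 / n\<close>, more than \<open>R ^ (-(m + 1))\<close>. An
  interval of length \<open>R ^ (-(m + 2))\<close>, hence the delay by two scales, is too short to meet two of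
  them. The threshold \<open>1 / (2 * R ^ 3)\<close> makes one component no longer than the cells of the next scale.
\<close>
lemma dist_int_lacunary_multiples:
  fixes n R m :: nat and x y :: real
  assumes n: "R ^ m \<le> n" "n < R ^ Suc m" and "2 \<le> R"
    and x: "dist_int (n * x) < 1 / (2 * R ^ 3)" and y: "dist_int (n * y) < 1 / (2 * R ^ 3)"
    and close: "\<bar>x - y\<bar> \<le> (1 / R) ^ (m + 2)"
  shows "\<bar>x - y\<bar> \<le> (1 / R) ^ (m + 3)"
proof -
  define p where "p = round (n * x)"
  define p' where "p' = round (n * y)"
  define e :: real where "e = 1 / R ^ 3"
  have px: "\<bar>n * x - p\<bar> < e / 2" and py: "\<bar>n * y - p'\<bar> < e / 2"
    using x y by (simp_all add: dist_int_def p_def p'_def e_def)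
  have e_le: "e \<le> 1 / 8"
    using power_mono[of 2 "real R" 3] \<open>2 \<le> R\<close> by (simp add: e_def divide_simps)
  have "n * \<bar>x - y\<bar> \<le> R ^ Suc m * (1 / R) ^ (m + 2)"
    using n close by (intro mult_mono) (auto simp del: power_Suc simp flip: of_nat_power)
  also have "\<dots> = 1 / R"
    using \<open>2 \<le> R\<close> by (simp add: power_add power_one_over field_simps power2_eq_square)
  also have "\<dots> \<le> 1 / 2"
    using \<open>2 \<le> R\<close> by (simp add: divide_simps)
  finally have "\<bar>n * x - n * y\<bar> \<le> 1 / 2"
    by (simp add: abs_mult flip: right_diff_distrib)
  then have "\<bar>real_of_int p - real_of_int p'\<bar> < 1"
    using px py e_le by linarith
  \<comment> \<open>Both points are close to the same multiple of \<open>1 / n\<close>.\<close>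
  then have "p = p'"
    by linarith
  then have "\<bar>n * x - n * y\<bar> \<le> e"
    using px py by linarith
  then have "n * \<bar>x - y\<bar> \<le> 1 / R ^ 3"
    by (simp add: e_def abs_mult flip: right_diff_distrib)
  moreover have "R ^ m * \<bar>x - y\<bar> \<le> n * \<bar>x - y\<bar>"
    using n by (intro mult_right_mono) (auto simp flip: of_nat_power)
  ultimately have "R ^ m * \<bar>x - y\<bar> \<le> 1 / R ^ 3" by linarith
  then show ?thesis
    using \<open>2 \<le> R\<close> by (simp add: power_add power_one_over field_simps)
qed

text \<open>
  For given \<open>q\<close>, Dirichlet's theorem at height \<open>Q\<close>, about \<open>2 * q / \<delta>\<close>, yields \<open>n \<le> Q\<close> with \<open>q \<parallel>n\<alpha>\<parallel> \<le> \<delta> / 2\<close>.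
  Replacing \<open>n\<close> by the minimiser of its block keeps this and enlarges \<open>n\<close> at most by the factor \<open>R\<close>. The
  identity \<open>N x = q (N \<alpha>) - N (q \<alpha> - x)\<close> then transfers \<open>\<parallel>N x\<parallel> \<ge> \<delta>\<close> to \<open>\<parallel>q\<alpha> - x\<parallel> \<ge> \<delta> / (2 N)\<close>.
\<close>
lemma mem_Bad_if_lacunary:
  fixes N :: "nat \<Rightarrow> nat" and R :: nat and \<alpha> \<delta> x :: real
  assumes "2 \<le> R" "0 < \<delta>" "\<delta> \<le> 1" "0 \<le> x" "x < 1"
    and N: "\<And>m. N m < R ^ Suc m" "\<And>m. 0 < N m"
    and N_min: "\<And>m n. R ^ m \<le> n \<Longrightarrow> n < R ^ Suc m \<Longrightarrow> dist_int (N m * \<alpha>) \<le> dist_int (n * \<alpha>)"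
    and far: "\<And>m. \<delta> \<le> dist_int (N m * x)"
  shows "x \<in> Bad \<alpha>"
proof -
  have "\<delta>\<^sup>2 / (6 * R) / q \<le> dist_int (q * \<alpha> - x)" if "1 \<le> q" for q :: nat
  proof -
    define Q where "Q = nat \<lceil>2 * q / \<delta>\<rceil>"
    have Q: "2 * q / \<delta> \<le> Q" "Q \<le> 2 * q / \<delta> + 1"
      using \<open>0 < \<delta>\<close> by (auto simp: Q_def of_nat_ceiling)
    have "0 < 2 * q / \<delta>" using that \<open>0 < \<delta>\<close> by simp
    then have "0 < Q" using Q by simp
    obtain h k where k: "0 < k" "k \<le> int Q" and hk: "\<bar>of_int k * \<alpha> - of_int h\<bar> < 1 / Q"
      using Dirichlet_approx[OF \<open>0 < Q\<close>, of \<alpha>] by metis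
    define n where "n = nat k"
    have n: "0 < n" "n \<le> Q" and n_approx: "dist_int (n * \<alpha>) < 1 / Q"
      using k hk dist_int_le[of "n * \<alpha>" h] by (auto simp: n_def)
    obtain m where m: "R ^ m \<le> n" "n < R ^ Suc m"
      using ex_power_ivl1[of R n] \<open>2 \<le> R\<close> n by auto
    \<comment> \<open>This absorbs the rounding in \<open>Q\<close>.\<close>
    have "1 \<le> q / \<delta>"
      using that assms by (simp add: divide_simps)
    have "N m \<le> R * n"
      using N(1)[of m] m by (metis less_imp_le_nat mult_le_mono2 order_trans power_Suc)
    then have "real (N m) \<le> R * Q"
      using n by (metis mult_le_mono2 of_nat_le_iff of_nat_mult order_trans)
    also have "\<dots> \<le> R * (3 * q / \<delta>)"
      unfolding of_nat_mult using Q \<open>1 \<le> q / \<delta>\<close> by (intro mult_left_mono) auto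
    finally have N_le: "N m \<le> R * (3 * q / \<delta>)" .
    have "dist_int (N m * \<alpha>) \<le> 1 / Q"
      using N_min[OF m] n_approx by simp
    also have "\<dots> \<le> \<delta> / (2 * q)"
      using Q \<open>0 < Q\<close> that \<open>0 < \<delta>\<close> by (simp add: field_simps)
    finally have "q * dist_int (N m * \<alpha>) \<le> \<delta> / 2"
      using that by (simp add: field_simps)
    define p where "p = round (q * \<alpha> - x)"
    define p' where "p' = round (N m * \<alpha>)"
    have "\<delta> \<le> \<bar>N m * x - of_int (int q * p' - int (N m) * p)\<bar>"
      using far[of m] dist_int_le order_trans by blast
    also have "\<dots> = \<bar>q * (N m * \<alpha> - p') - N m * (q * \<alpha> - x - p)\<bar>"
      by (simp add: algebra_simps)
    also have "\<dots> \<le> q * dist_int (N m * \<alpha>) + N m * dist_int (q * \<alpha> - x)"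
      unfolding dist_int_def p_def[symmetric] p'_def[symmetric]
      by (rule order_trans[OF abs_triangle_ineq4]) (simp add: abs_mult)
    finally have "\<delta> / 2 \<le> N m * dist_int (q * \<alpha> - x)"
      using \<open>q * dist_int (N m * \<alpha>) \<le> \<delta> / 2\<close> by simp
    also have "\<dots> \<le> R * (3 * q / \<delta>) * dist_int (q * \<alpha> - x)"
      by (rule mult_right_mono[OF N_le]) (simp add: dist_int_def)
    finally show ?thesis
      using that \<open>0 < \<delta>\<close> \<open>2 \<le> R\<close> by (simp add: field_simps power2_eq_square)
  qed
  moreover have "0 < \<delta>\<^sup>2 / (6 * R)"
    using \<open>0 < \<delta>\<close> \<open>2 \<le> R\<close> by simp
  ultimately show ?thesis
    using assms(4,5) unfolding Bad_def by blast
qed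

section \<open>The Hausdorff dimension of \<open>Bad\<close>\<close>

text \<open>
  The avoidance lemma is applied with \<open>V m\<close> the set where the multiple \<open>N (m - 2)\<close> of \<open>x\<close> is close to an
  integer; the first two scales carry no condition. The point \<open>1\<close>, which the lemma permits, is excluded by the
  conditions themselves, since its multiples are integers.
\<close>
lemma Bad_not_covered:
  assumes s: "0 < s" "s < 1"
  shows "\<exists>\<epsilon>>0. \<forall>U w. (\<forall>i. 0 < w i) \<longrightarrow> summable w \<longrightarrow> suminf w < \<epsilon> \<longrightarrow>
    (\<forall>i. \<forall>x\<in>U i. \<forall>y\<in>U i. \<bar>x - y\<bar> powr s \<le> w i) \<longrightarrow> \<not> Bad \<alpha> \<subseteq> (\<Union>i::nat. U i)"
proof -
  have "eventually (\<lambda>R::nat. 3 * real R powr s \<le> real R - 3) at_top"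
    using s by real_asymp
  then obtain R where R: "2 \<le> R" "3 * real R powr s \<le> real R - 3"
    using eventually_happens[OF eventually_conj[OF eventually_ge_at_top[of 2]]] by auto
  define \<delta> :: real where "\<delta> = 1 / (2 * R ^ 3)"
  have \<delta>: "0 < \<delta>" "\<delta> \<le> 1"
    using R power_mono[of 2 "real R" 3] by (auto simp: \<delta>_def divide_simps)
  have "\<exists>N. R ^ m \<le> N \<and> N < R ^ Suc m \<and>
      (\<forall>n. R ^ m \<le> n \<and> n < R ^ Suc m \<longrightarrow> dist_int (N * \<alpha>) \<le> dist_int (n * \<alpha>))" for m
    using ex_min_if_finite[of "(\<lambda>n. dist_int (real n * \<alpha>)) ` {R ^ m..<R ^ Suc m}"] R
    by (fastforce simp: not_less)
  then obtain N where N: "\<And>m. R ^ m \<le> N m" "\<And>m. N m < R ^ Suc m"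
    and N_min: "\<And>m n. R ^ m \<le> n \<Longrightarrow> n < R ^ Suc m \<Longrightarrow> dist_int (N m * \<alpha>) \<le> dist_int (n * \<alpha>)"
    by metis
  have N_pos: "0 < N m" for m
    using N(1)[of m] R by (metis less_le_trans not_numeral_le_zero zero_less_iff_neq_zero zero_less_power)
  define V where "V m = {x::real. 2 \<le> m \<and> dist_int (N (m - 2) * x) < \<delta>}" for m
  have V: "\<bar>x - y\<bar> \<le> (1 / R) ^ Suc m"
    if "x \<in> V m" "y \<in> V m" "\<bar>x - y\<bar> \<le> (1 / R) ^ m" for m x y
  proof -
    have "2 \<le> m"
      using that(1) by (simp add: V_def)
    then obtain k where m: "m = k + 2"
      using le_Suc_ex[of 2 m] by auto
    show ?thesis
      using dist_int_lacunary_multiples[OF N(1)[of k] N(2)[of k] R(1), of x y] that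
      by (simp add: V_def m \<delta>_def numeral_3_eq_3 del: power_Suc)
  qed
  have "\<not> Bad \<alpha> \<subseteq> (\<Union>i::nat. U i)"
    if w: "\<forall>i. 0 < w i" "summable w" "suminf w < (1 / R) powr s"
      "\<forall>i. \<forall>x\<in>U i. \<forall>y\<in>U i. \<bar>x - y\<bar> powr s \<le> w i" for U w
  proof -
    interpret weighted_cover s R U w
      using s R w by unfold_locales auto
    obtain x where x: "0 \<le> x" "x \<le> 1" "\<And>m. x \<notin> V m" "\<And>i. x \<notin> U i"
      using exists_point_avoiding[OF w(3) V] by blast
    have far: "\<delta> \<le> dist_int (N m * x)" for m
      using x(3)[of "m + 2"] by (simp add: V_def)
    have "x \<noteq> 1"
      using far[of 0] \<delta> by (auto simp: dist_int_def)
    then have "x \<in> Bad \<alpha>"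
      using mem_Bad_if_lacunary[OF R(1) \<delta> _ _ N(2) N_pos N_min far] x by simp
    then show ?thesis
      using x(4) by auto
  qed
  then show ?thesis
    using R by (intro exI[of _ "(1 / R) powr s"]) auto
qed

text \<open>
  Adding a geometric series to the numbers \<open>diameter (U i) powr s\<close> makes the weights positive; half of the
  admissible total is reserved for it. For \<open>s = 0\<close> only nonemptiness of \<^term>\<open>Bad \<alpha>\<close> is at stake, and this is the
  failure of the cover by empty sets for any one exponent, here \<open>1 / 2\<close>.
\<close>
lemma hausdorff_measure_Bad_pos:
  assumes s: "0 \<le> s" "s < 1"
  shows "hausdorff_measure s (Bad \<alpha>) \<noteq> 0"
proof (cases "s = 0")
  case True
  obtain \<epsilon> :: real where "\<epsilon> > 0" and \<epsilon>: "\<And>U w. (\<forall>i. 0 < w i) \<Longrightarrow> summable w \<Longrightarrow> suminf w < \<epsilon> \<Longrightarrow>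
    (\<forall>i. \<forall>x\<in>U i. \<forall>y\<in>U i. \<bar>x - y\<bar> powr (1 / 2) \<le> w i) \<Longrightarrow> \<not> Bad \<alpha> \<subseteq> (\<Union>i::nat. U i)"
    using Bad_not_covered[of "1 / 2" \<alpha>] by auto
  have sums: "(\<lambda>i. \<epsilon> / 2 * (1 / 2) ^ Suc i) sums (\<epsilon> / 2)"
    using sums_mult[OF power_half_series, of "\<epsilon> / 2"] by simp
  have "Bad \<alpha> \<noteq> {}"
    using \<epsilon>[of "\<lambda>i. \<epsilon> / 2 * (1 / 2) ^ Suc i" "\<lambda>_. {}"] \<open>\<epsilon> > 0\<close> sums
    by (auto simp: sums_iff simp del: power_Suc)
  have "1 \<le> (\<Sum>i. diam_pow 0 (U i))" if "U \<in> delta_covers 1 (Bad \<alpha>)" for U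
  proof -
    obtain i :: nat where "U i \<noteq> {}"
      using \<open>U \<in> delta_covers 1 (Bad \<alpha>)\<close> \<open>Bad \<alpha> \<noteq> {}\<close> unfolding delta_covers_def by blast
    then have "(\<Sum>j\<in>{i}. diam_pow 0 (U j)) = 1"
      by (simp add: diam_pow_def)
    then show ?thesis
      using sum_le_suminf[of "\<lambda>i. diam_pow 0 (U i)" "{i}"] by simp
  qed
  then have "1 \<le> hausdorff_premeasure 0 1 (Bad \<alpha>)"
    unfolding hausdorff_premeasure_def by (rule INF_greatest)
  also have "\<dots> \<le> hausdorff_measure s (Bad \<alpha>)"
    unfolding hausdorff_measure_def True by (rule SUP_upper) simp
  finally show ?thesis by auto
next
  case False
  obtain \<epsilon> :: real where "\<epsilon> > 0" and \<epsilon>: "\<And>U w. (\<forall>i. 0 < w i) \<Longrightarrow> summable w \<Longrightarrow> suminf w < \<epsilon> \<Longrightarrow>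
    (\<forall>i. \<forall>x\<in>U i. \<forall>y\<in>U i. \<bar>x - y\<bar> powr s \<le> w i) \<Longrightarrow> \<not> Bad \<alpha> \<subseteq> (\<Union>i::nat. U i)"
    using Bad_not_covered[of s \<alpha>] s False by auto
  have sums: "(\<lambda>i. \<epsilon> / 2 * (1 / 2) ^ Suc i) sums (\<epsilon> / 2)"
    using sums_mult[OF power_half_series, of "\<epsilon> / 2"] by simp
  have "ennreal (\<epsilon> / 2) \<le> (\<Sum>i. diam_pow s (U i))" if U: "U \<in> delta_covers 1 (Bad \<alpha>)" for U
  proof (rule ccontr)
    define d where "d i = diameter (U i) powr s" for i
    assume "\<not> ?thesis"
    then have less: "(\<Sum>i. ennreal (d i)) < ennreal (\<epsilon> / 2)"
      using False by (simp add: diam_pow_def d_def)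
    then have d: "summable d"
      by (intro summable_suminf_not_top) (auto simp: d_def top_unique)
    then have "suminf d < \<epsilon> / 2"
      using less \<open>\<epsilon> > 0\<close> by (subst (asm) suminf_ennreal2) (auto simp: d_def ennreal_less_iff suminf_nonneg)
    then have "(\<Sum>i. d i + \<epsilon> / 2 * (1 / 2) ^ Suc i) < \<epsilon>"
      using suminf_add[OF d sums_summable[OF sums]] sums_unique[OF sums] by simp
    moreover have "0 < d i + \<epsilon> / 2 * (1 / 2) ^ Suc i" for i
      using \<open>\<epsilon> > 0\<close> by (intro add_nonneg_pos) (auto simp: d_def)
    moreover have "\<bar>x - y\<bar> powr s \<le> d i + \<epsilon> / 2 * (1 / 2) ^ Suc i" if "x \<in> U i" "y \<in> U i" for x y i
    proof -
      have "\<bar>x - y\<bar> \<le> diameter (U i)"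
        using diameter_bounded_bound[of "U i" x y] U that by (simp add: delta_covers_def dist_real_def)
      then have "\<bar>x - y\<bar> powr s \<le> d i"
        unfolding d_def using s by (intro powr_mono2) auto
      then show ?thesis using \<open>\<epsilon> > 0\<close> by (auto intro: add_increasing2)
    qed
    ultimately have "\<not> Bad \<alpha> \<subseteq> (\<Union>i. U i)"
      using summable_add[OF d sums_summable[OF sums]] by (intro \<epsilon>) auto
    then show False
      using U by (simp add: delta_covers_def)
  qed
  then have "ennreal (\<epsilon> / 2) \<le> hausdorff_premeasure s 1 (Bad \<alpha>)"
    unfolding hausdorff_premeasure_def by (rule INF_greatest)
  also have "\<dots> \<le> hausdorff_measure s (Bad \<alpha>)"
    unfolding hausdorff_measure_def by (rule SUP_upper) simp
  finally show ?thesis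
    using \<open>\<epsilon> > 0\<close> by (auto simp: ennreal_eq_0_iff)
qed

text \<open>The \<open>n\<close> intervals of length \<open>1 / n\<close> contribute \<open>n powr (1 - s)\<close>, which tends to \<open>0\<close>.\<close>
lemma hausdorff_measure_subset_unit_interval_eq_0:
  fixes A :: "real set"
  assumes A: "A \<subseteq> {0..<1}" and s: "1 < s"
  shows "hausdorff_measure s A = 0"
proof -
  have "hausdorff_premeasure s \<delta> A = 0" if "\<delta> > 0" for \<delta>
  proof -
    have le: "hausdorff_premeasure s \<delta> A \<le> ennreal (real n powr (1 - s))" if n: "n > 0" "1 / n \<le> \<delta>" for n :: nat
    proof -
      define U where "U i = (if i < n then {real i / n..(real i + 1) / n} else {})" for i
      have diam: "diameter (U i) = (if i < n then 1 / n else 0)" for i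
        using n by (simp add: U_def diameter_closed_interval divide_simps diff_divide_distrib[symmetric])
      have "A \<subseteq> (\<Union>i. U i)"
      proof
        fix x assume "x \<in> A"
        then have x: "0 \<le> x" "x < 1" using A by auto
        define i where "i = nat \<lfloor>n * x\<rfloor>"
        have i: "real i = of_int \<lfloor>n * x\<rfloor>"
          using x by (simp add: i_def)
        have "real i \<le> n * x" "n * x < real i + 1"
          unfolding i by linarith+
        moreover have "real n * x < n"
          using x n by simp
        ultimately have "real i < n" by linarith
        then have "x \<in> U i"
          using \<open>real i \<le> n * x\<close> \<open>n * x < real i + 1\<close> n by (simp add: U_def field_simps)
        then show "x \<in> (\<Union>i. U i)" by blast
      qed
      then have "U \<in> delta_covers \<delta> A"
        using n \<open>\<delta> > 0\<close> by (auto simp: delta_covers_def diam) (simp add: U_def)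
      then have "hausdorff_premeasure s \<delta> A \<le> (\<Sum>i. diam_pow s (U i))"
        unfolding hausdorff_premeasure_def by (rule INF_lower)
      also have "\<dots> = (\<Sum>i<n. diam_pow s (U i))"
        using s by (intro suminf_finite) (auto simp: diam_pow_def diam)
      also have "\<dots> = ennreal (n * (1 / n) powr s)"
        using s by (simp add: diam_pow_def diam ennreal_mult ennreal_of_nat_eq_real_of_nat)
      also have "n * (1 / n) powr s = real n powr (1 - s)"
        using n by (simp add: powr_diff powr_divide)
      finally show ?thesis .
    qed
    have "(\<lambda>n::nat. real n powr (1 - s)) \<longlonglongrightarrow> 0"
      using s by real_asymp
    then have lim: "(\<lambda>n::nat. ennreal (real n powr (1 - s))) \<longlonglongrightarrow> 0"
      using tendsto_ennrealI by fastforce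
    have "eventually (\<lambda>n::nat. 1 / real n < \<delta>) sequentially"
      using order_tendstoD(2)[OF lim_1_over_n \<open>\<delta> > 0\<close>] by simp
    then have "eventually (\<lambda>n::nat. n > 0 \<and> 1 / n \<le> \<delta>) sequentially"
      using eventually_gt_at_top[of 0] by eventually_elim simp
    then have "hausdorff_premeasure s \<delta> A \<le> 0"
      by (intro tendsto_lowerbound[OF lim]) (auto elim!: eventually_mono intro: le)
    then show ?thesis by simp
  qed
  then show ?thesis
    unfolding hausdorff_measure_def by (simp add: SUP_constant)
qed

theorem corollary1:
  fixes \<alpha> :: real
  shows "hausdorff_dim (Bad \<alpha>) = 1"
proof (rule antisym)
  show "1 \<le> hausdorff_dim (Bad \<alpha>)"
    unfolding hausdorff_dim_def
  proof (rule INF_greatest)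
    fix s :: real assume "s \<in> {s. 0 \<le> s \<and> hausdorff_measure s (Bad \<alpha>) = 0}"
    then have "1 \<le> s"
      using hausdorff_measure_Bad_pos[of s \<alpha>] by force
    then show "1 \<le> ennreal s" by simp
  qed
  have dim_le: "hausdorff_dim (Bad \<alpha>) \<le> ennreal (1 + e)" if "0 < e" for e :: real
    unfolding hausdorff_dim_def
  proof (rule INF_lower)
    have "Bad \<alpha> \<subseteq> {0..<1}" by (auto simp: Bad_def)
    then show "1 + e \<in> {s. 0 \<le> s \<and> hausdorff_measure s (Bad \<alpha>) = 0}"
      using hausdorff_measure_subset_unit_interval_eq_0 that by auto
  qed
  show "hausdorff_dim (Bad \<alpha>) \<le> 1"
    by (rule ennreal_le_epsilon) (use dim_le in simp)
qed

end
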